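(* Let $\{\tau(n), n\ge 1\}$ denote the indices, in increasing order, of the weight-$2$ terms of the Binary Two-Up Sequence. The generating function $$P(x)=\sum_{n=1}^{\infty} x^{\tau(n)}$$ is equal to $$P_S+\sum_{k=1}^{\infty} x^{12\cdot 2^k+1}\left(\frac{1-x^{12(2^{k-1}-1)}}{1-x^{12}}\,P_{VW}+x^{12(2^{k-1}-1)}\,P_{XU}\right)\left(1+x^{12\cdot 2^{k-1}}\right),$$ where $P_S=x^5+x^9+x^{13}+x^{15}+x^{19}+x^{21}$, $P_{VW}=1+x^4+x^6+x^{10}$, and $P_{XU}=1+x^4+x^6+x^8$.
   Context: Two nonnegative integers are perpendicular if their binary expansions have no $1$ in the same bit-position. The Binary Two-Up Sequence $\{a(n)\}_{n\ge 0}$ is defined by: for each $n\ge 0$, $a(n)$ is the smallest nonnegative integer not among $a(0),\ldots,a(n-1)$ that is perpendicular to each of $a(\lceil n/2\rceil),\ldots,a(n-1)$, i.e. to each of the previous $\lfloor n/2\rfloor$ terms. It begins $0,1,2,4,8,3,16,32,64,12,128,\ldots$. The weight of a nonnegative integer is the number of $1$'s in its binary expansion; "weight-$2$ term" means a term $a(i)$ of weight $2$, and its index is $i$. The sequence $\tau$ begins $5,9,13,15,19,21,25,29,31,33,37,\ldots$. Generating functions are formal power series in $x$. *)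

theory Defs
  imports
    "HOL-Library.Infinite_Set"
    "HOL-Computational_Algebra.Formal_Power_Series"
begin

definition perpendicular :: "nat \<Rightarrow> nat \<Rightarrow> bool" where
  "perpendicular m n \<longleftrightarrow> (\<forall>k. \<not> (bit m k \<and> bit n k))"

definition weight :: "nat \<Rightarrow> nat" where
  "weight m = card {k. bit m k}"

text \<open>
  The lower end \<open>nat \<lceil>real n / 2\<rceil>\<close> of the window leaves the previous \<open>\<lfloor>n/2\<rfloor>\<close> terms.
  Distinctness is required from all earlier terms, perpendicularity only from those in the window.
\<close>

function two_up :: "nat \<Rightarrow> nat" where
  "two_up n = (LEAST m. m \<notin> two_up ` {0..<n} \<and>
     (\<forall>i \<in> {nat \<lceil>real n / 2\<rceil>..<n}. perpendicular m (two_up i)))"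
  by auto
termination
  by (relation "measure id") auto

declare two_up.simps [simp del]

text \<open>The least element in the recursion is never taken over an empty set.\<close>

lemma two_up_candidate:
  "\<exists>m. m \<notin> two_up ` {0..<n} \<and>
     (\<forall>i \<in> {nat \<lceil>real n / 2\<rceil>..<n}. perpendicular m (two_up i))"
proof -
  define K where "K = Suc (\<Sum>i<n. two_up i)"
  have lt: "two_up i < 2 ^ K" if "i < n" for i
  proof -
    have "two_up i \<le> (\<Sum>i<n. two_up i)"
      using that by (intro member_le_sum) auto
    also have "\<dots> < K"
      by (simp add: K_def)
    also have "K < 2 ^ K"
      by (rule less_exp)
    finally show ?thesis .
  qed
  have "\<not> bit (two_up i) K" if "i < n" for i
    using lt[OF that] by (simp add: bit_iff_odd)
  then have "perpendicular (2 ^ K) (two_up i)" if "i < n" for i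
    using that by (auto simp: perpendicular_def bit_exp_iff)
  moreover have "2 ^ K \<notin> two_up ` {0..<n}"
    using lt by fastforce
  ultimately show ?thesis
    by (intro exI[of _ "2 ^ K"]) auto
qed

definition weight2_indices :: "nat set" where
  "weight2_indices = {i. weight (two_up i) = 2}"

text \<open>
  \<open>enumerate\<close> counts from \<open>0\<close>, whereas \<open>\<tau>\<close> is indexed by \<open>n \<ge> 1\<close>; the value \<open>tau 0\<close> is
  meaningless.
\<close>

definition tau :: "nat \<Rightarrow> nat" where
  "tau n = enumerate weight2_indices (n - 1)"

definition P_S :: "rat fps" where
  "P_S = fps_X ^ 5 + fps_X ^ 9 + fps_X ^ 13 + fps_X ^ 15 + fps_X ^ 19 + fps_X ^ 21"

definition P_VW :: "rat fps" where
  "P_VW = 1 + fps_X ^ 4 + fps_X ^ 6 + fps_X ^ 10"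

definition P_XU :: "rat fps" where
  "P_XU = 1 + fps_X ^ 4 + fps_X ^ 6 + fps_X ^ 8"

text \<open>The \<open>k\<close>-th summand of the closed form, for \<open>k \<ge> 1\<close>.\<close>

definition P_block :: "nat \<Rightarrow> rat fps" where
  "P_block k =
     fps_X ^ (12 * 2 ^ k + 1)
     * ((1 - fps_X ^ (12 * (2 ^ (k - 1) - 1))) / (1 - fps_X ^ 12) * P_VW
        + fps_X ^ (12 * (2 ^ (k - 1) - 1)) * P_XU)
     * (1 + fps_X ^ (12 * 2 ^ (k - 1)))"

end

theory Submission
  imports Defs "HOL-Library.Disjoint_Sets"
begin

text \<open>
  Going from step \<open>2 * m\<close> to step \<open>2 * m + 1\<close>, exactly the bits of term \<open>m\<close> leave the window. Call a bit
  old if it has occurred already. If all sets of free old bits have been used, the next term is a new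
  power of two, and this happens at every positive even index. At an odd index there are at most three
  free old bits: at most two left over from earlier steps, and those of term \<open>m\<close>. If some pair of them
  is unused, the next term has weight 2 and at most one bit is left over. Hence the weight of term
  \<open>2 * m + 1\<close> and the next number of left-over bits depend only on the weight of term \<open>m\<close> and the current
  number of left-over bits; the identity of the bits is never needed, apart from the freshness
  argument which shows that an unused pair exists. Running this automaton over six consecutive \<open>m\<close>
  doubles the weight pattern.
\<close>

subsection \<open>Free bits\<close>

definition bits :: "nat \<Rightarrow> nat set" where
  "bits x = {k. bit x k}"

abbreviation term_bits :: "nat \<Rightarrow> nat set" where
  "term_bits n \<equiv> bits (two_up n)"

lemma bits_eq_iff: "bits x = bits y \<longleftrightarrow> x = y"
  by (metis bit_eqI bits_def mem_Collect_eq)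

lemma bits_0 [simp]: "bits 0 = {}"
  by (simp add: bits_def)

lemma bits_exp [simp]: "bits (2 ^ k) = {k}"
  by (auto simp: bits_def bit_exp_iff)

lemma bits_surj:
  assumes "finite S"
  obtains x where "bits x = S"
proof -
  have "\<exists>x. bits x = S"
    using assms
  proof (induction S)
    case empty
    then show ?case by (intro exI[of _ 0]) simp
  next
    case (insert k S)
    then obtain x where "bits x = S" by blast
    then have "bits (set_bit k x) = insert k S"
      by (auto simp: bits_def bit_set_bit_iff)
    then show ?case by blast
  qed
  then show thesis using that by blast
qed

lemma exp_le_if_bit: "k \<in> bits x \<Longrightarrow> 2 ^ k \<le> x"
  unfolding bits_def bit_iff_odd
  by (cases "x < 2 ^ k") auto

lemma bits_subset_lessThan_iff: "bits x \<subseteq> {..<k} \<longleftrightarrow> x < 2 ^ k"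
proof
  assume "bits x \<subseteq> {..<k}"
  then have "take_bit k x = x"
    by (auto intro!: bit_eqI simp: bits_def bit_take_bit_iff)
  then show "x < 2 ^ k"
    by (simp add: take_bit_nat_eq_self_iff)
next
  assume "x < 2 ^ k"
  then show "bits x \<subseteq> {..<k}"
    by (metis exp_le_if_bit le_less_trans lessThan_iff one_less_numeral_iff power_strict_increasing_iff semiring_norm(76) subsetI)
qed

lemma bits_subset_imp_le:
  assumes "bits x \<subseteq> bits y"
  shows "x \<le> y"
proof -
  have "and x y = x"
    using assms by (auto intro!: bit_eqI simp: bits_def bit_and_iff)
  then show ?thesis
    using AND_upper2''[of "int y" "int y" "int x"] by (metis AND_upper2 of_nat_0_le_iff of_nat_and_eq of_nat_le_iff)
qed

lemma perpendicular_iff: "perpendicular x y \<longleftrightarrow> bits x \<inter> bits y = {}"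
  by (auto simp: perpendicular_def bits_def)

lemma weight_eq: "weight x = card (bits x)"
  by (simp add: weight_def bits_def)

lemma finite_bits [simp]: "finite (bits x)"
  by (meson bits_subset_lessThan_iff finite_lessThan finite_subset less_exp)

definition admissible :: "nat \<Rightarrow> nat \<Rightarrow> bool" where
  "admissible n x \<longleftrightarrow> (\<forall>i<n. x \<noteq> two_up i) \<and> (\<forall>i<n. n \<le> 2 * i \<longrightarrow> bits x \<inter> term_bits i = {})"

lemma window_iff: "nat \<lceil>real n / 2\<rceil> \<le> i \<longleftrightarrow> n \<le> 2 * i"
  by linarith

lemma admissible_alt:
  "admissible n x \<longleftrightarrow> x \<notin> two_up ` {0..<n} \<and>
     (\<forall>i \<in> {nat \<lceil>real n / 2\<rceil>..<n}. perpendicular x (two_up i))"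
  by (auto simp: admissible_def perpendicular_iff window_iff)

lemma two_up_eq_Least: "two_up n = (LEAST x. admissible n x)"
  unfolding admissible_alt by (rule two_up.simps)

lemma admissible_two_up: "admissible n (two_up n)"
proof -
  have "\<exists>x. admissible n x"
    unfolding admissible_alt by (rule two_up_candidate)
  then show ?thesis
    unfolding two_up_eq_Least by (rule LeastI_ex)
qed

lemma two_up_le: "admissible n x \<Longrightarrow> two_up n \<le> x"
  unfolding two_up_eq_Least by (rule Least_le)


lemma two_up_inj:
  assumes "term_bits i = term_bits j"
  shows "i = j"
proof -
  have "two_up i \<noteq> two_up j" if "i < j" for i j
    using admissible_two_up[of j] that by (auto simp: admissible_def)
  with assms show ?thesis
    by (metis bits_eq_iff linorder_neqE_nat)
qed

lemma term_bits_disjoint: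
  "i < j \<Longrightarrow> j \<le> 2 * i \<Longrightarrow> term_bits j \<inter> term_bits i = {}"
  using admissible_two_up[of j] by (auto simp: admissible_def)

section \<open>Used sets, old bits and free bits\<close>

definition used :: "nat \<Rightarrow> nat set \<Rightarrow> bool" where
  "used n S \<longleftrightarrow> (\<exists>i<n. term_bits i = S)"

definition occurring :: "nat \<Rightarrow> nat set" where
  "occurring n = (\<Union>i<n. term_bits i)"

text \<open>The window start \<open>s\<close> is kept independent of \<open>n\<close>, so that a
  step splits into two moves: \<open>free_from_drop\<close> advances \<open>s\<close>,
  \<open>free_from_Suc\<close> advances \<open>n\<close>.\<close>

definition free_from :: "nat \<Rightarrow> nat \<Rightarrow> nat set" where
  "free_from s n = occurring n - (\<Union>i\<in>{s..<n}. term_bits i)"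

lemma finite_occurring [simp]: "finite (occurring n)"
  by (simp add: occurring_def)

lemma finite_free_from [simp]: "finite (free_from s n)"
  by (simp add: free_from_def)

lemma occurring_Suc: "occurring (Suc n) = occurring n \<union> term_bits n"
  by (auto simp: occurring_def lessThan_Suc)

lemma free_from_Suc:
  "s \<le> n \<Longrightarrow> free_from s (Suc n) = (free_from s n \<union> (term_bits n - occurring n)) - term_bits n"
  by (auto simp: free_from_def occurring_Suc atLeastLessThanSuc)

text \<open>The two inequalities pin \<open>s\<close> down as the start of the window for
  \<open>n\<close>. A bit that has never occurred cannot collide with the window, so only the old
  bits of \<open>x\<close> are constrained.\<close>

lemma admissible_iff:
  assumes "n \<le> 2 * s" "2 * s \<le> n + 1"
  shows "admissible n x \<longleftrightarrow> \<not> used n (bits x) \<and> bits x \<inter> occurring n \<subseteq> free_from s n"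
proof -
  have *: "n \<le> 2 * i \<longleftrightarrow> s \<le> i" for i
    using assms by linarith
  have "(\<forall>i<n. s \<le> i \<longrightarrow> bits x \<inter> term_bits i = {}) \<longleftrightarrow> bits x \<inter> occurring n \<subseteq> free_from s n"
    by (auto simp: free_from_def occurring_def)
  moreover have "(\<forall>i<n. x \<noteq> two_up i) \<longleftrightarrow> \<not> used n (bits x)"
    by (auto simp: used_def bits_eq_iff)
  ultimately show ?thesis
    by (simp add: admissible_def *)
qed

lemma used_mono: "used n S \<Longrightarrow> n \<le> m \<Longrightarrow> used m S"
  by (force simp: used_def)

lemma used_term: "i < n \<Longrightarrow> used n (term_bits i)"
  by (auto simp: used_def)

lemma not_used_term_self: "\<not> used n (term_bits n)"
  using two_up_inj by (auto simp: used_def)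

lemma used_subset_occurring: "used n S \<Longrightarrow> S \<subseteq> occurring n"
  by (auto simp: used_def occurring_def)

text \<open>A number made of free old bits would be a used set, so the term contains a bit from
  \<open>k\<close> upwards and is at least \<open>2 ^ k\<close>; and \<open>2 ^ k\<close> itself is
  admissible.\<close>

lemma term_new_bit:
  assumes window: "n \<le> 2 * s" "2 * s \<le> n + 1"
    and occ: "occurring n = {..<k}"
    and all_used: "\<And>S. S \<subseteq> free_from s n \<Longrightarrow> used n S"
  shows "term_bits n = {k}"
proof -
  have "admissible n (2 ^ k)"
    using used_subset_occurring[of n "{k}"] by (auto simp: admissible_iff[OF window] occ)
  then have le: "two_up n \<le> 2 ^ k"
    by (rule two_up_le)
  have "admissible n (two_up n)"
    by (rule admissible_two_up)
  then have "\<not> term_bits n \<subseteq> {..<k}"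
    using all_used by (auto simp: admissible_iff[OF window] occ)
  then have "2 ^ k \<le> two_up n"
    by (simp add: bits_subset_lessThan_iff)
  with le have "two_up n = 2 ^ k"
    by simp
  then show ?thesis
    by simp
qed

text \<open>The set \<open>S\<close> encodes an admissible number below \<open>2 ^ k\<close>, so the
  least admissible number needs no new bit. A term properly containing \<open>S\<close> would exceed
  that number.\<close>

lemma term_reuses_bits:
  assumes window: "n \<le> 2 * s" "2 * s \<le> n + 1"
    and occ: "occurring n = {..<k}"
    and S: "S \<subseteq> free_from s n" "\<not> used n S"
  shows "term_bits n \<subseteq> free_from s n" and "\<not> S \<subset> term_bits n"
proof -
  have "finite S"
    using S(1) by (rule finite_subset) simp
  then obtain x where x: "bits x = S"
    by (rule bits_surj)
  have "admissible n x"
    using S by (auto simp: admissible_iff[OF window] x)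
  then have le: "two_up n \<le> x"
    by (rule two_up_le)
  have "S \<subseteq> {..<k}"
    using S(1) occ by (auto simp: free_from_def)
  then have "x < 2 ^ k"
    using x bits_subset_lessThan_iff by auto
  with le have "term_bits n \<subseteq> {..<k}"
    by (simp add: bits_subset_lessThan_iff)
  then show "term_bits n \<subseteq> free_from s n"
    using admissible_two_up[of n] by (auto simp: admissible_iff[OF window] occ)
  show "\<not> S \<subset> term_bits n"
  proof
    assume "S \<subset> term_bits n"
    then have "x \<le> two_up n" and "x \<noteq> two_up n"
      using bits_subset_imp_le x by auto
    with le show False by simp
  qed
qed

lemma free_from_drop:
  assumes "s < n" and "\<And>i. s < i \<Longrightarrow> i < n \<Longrightarrow> term_bits i \<inter> term_bits s = {}"
  shows "free_from (Suc s) n = free_from s n \<union> term_bits s"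
    and "free_from s n \<inter> term_bits s = {}"
proof -
  have "{s..<n} = insert s {Suc s..<n}"
    using assms(1) by auto
  then have "free_from s n = free_from (Suc s) n - term_bits s"
    by (auto simp: free_from_def)
  moreover have "term_bits s \<subseteq> free_from (Suc s) n"
    using assms(1) assms(2)[OF Suc_le_lessD] by (fastforce simp: free_from_def occurring_def)
  ultimately show "free_from (Suc s) n = free_from s n \<union> term_bits s"
    by blast
  show "free_from s n \<inter> term_bits s = {}"
    using assms(1) by (auto simp: free_from_def)
qed

subsection \<open>The evolution of the set of free old bits\<close>

text \<open>
  The clause about \<open>{y}\<close> says that a bit occurs for the first time as a power of two; the last clause
  keeps track of pairs that contain a bit that had never been in a pair before.
\<close>

definition regular :: "nat \<Rightarrow> bool" where
  "regular n \<longleftrightarrow>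
     n > 0 \<and>
     (\<exists>k. occurring n = {..<k}) \<and>
     (\<forall>j\<in>occurring n. used n {j}) \<and>
     (\<forall>i<n. \<forall>y. term_bits i = {y} \<longrightarrow> y \<notin> occurring i) \<and>
     (\<forall>i<n. 0 < i \<and> even i \<longrightarrow> card (term_bits i) = 1) \<and>
     (\<forall>i. 2 * i + 1 < n \<and> card (term_bits i) = 1 \<and> card (term_bits (2 * i + 1)) = 2
        \<longrightarrow> term_bits i \<subseteq> term_bits (2 * i + 1))"

lemma two_up_0 [simp]: "two_up 0 = 0"
  using two_up_le[of 0 0] by (simp add: admissible_def)

lemma regular_1: "regular 1"
  by (auto simp: regular_def occurring_def intro!: exI[of _ 0])

lemma regular_used_small:
  assumes "regular n" "S \<subseteq> occurring n" "card S \<le> 1"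
  shows "used n S"
proof -
  have fin: "finite S"
    using assms(2) by (rule finite_subset) simp
  show ?thesis
  proof (cases "S = {}")
    case True
    then show ?thesis
      using assms(1) used_term[of 0 n] by (simp add: regular_def)
  next
    case False
    with fin assms(3) have "card S = 1"
      by (simp add: le_Suc_eq)
    then obtain j where "S = {j}"
      by (rule card_1_singletonE)
    then show ?thesis
      using assms by (simp add: regular_def)
  qed
qed

text \<open>The freshness argument: \<open>y\<close> occurs for the first time at \<open>i\<close>,
  and the window keeps it away from the terms \<open>i + 1\<close> to \<open>2 * i\<close>.\<close>

lemma regular_single_recurs:
  assumes "regular n" "i < n" "term_bits i = {y}" "j \<le> 2 * i" "y \<in> term_bits j"
  shows "j = i"
proof (rule ccontr)
  assume "j \<noteq> i"
  then consider "j < i" | "i < j" by linarith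
  then show False
  proof cases
    case 1
    then have "y \<in> occurring i"
      using assms(5) by (auto simp: occurring_def)
    then show False
      using assms(1-3) by (simp add: regular_def)
  next
    case 2
    then show False
      using term_bits_disjoint[of i j] assms(3-5) by auto
  qed
qed

lemma regular_new:
  assumes reg: "regular n"
    and window: "n \<le> 2 * s" "2 * s \<le> n + 1"
    and all_used: "\<And>S. S \<subseteq> free_from s n \<Longrightarrow> used n S"
  shows "regular (Suc n)" "card (term_bits n) = 1" "free_from s (Suc n) = free_from s n"
proof -
  obtain k where occ: "occurring n = {..<k}"
    using reg by (auto simp: regular_def)
  have new: "term_bits n = {k}"
    by (rule term_new_bit[OF window occ all_used])
  then show "card (term_bits n) = 1"
    by simp
  have "0 < n"
    using reg by (simp add: regular_def)
  with window have "s \<le> n"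
    by linarith
  then show "free_from s (Suc n) = free_from s n"
    by (auto simp: free_from_Suc new occ) (auto simp: free_from_def occ)
  have "occurring (Suc n) = {..<Suc k}"
    by (auto simp: occurring_Suc new occ)
  moreover have "used (Suc n) {j}" if "j < Suc k" for j
  proof (cases "j = k")
    case True
    then show ?thesis
      using used_term[of n "Suc n"] new by simp
  next
    case False
    then show ?thesis
      using that reg occ used_mono[of n "{j}" "Suc n"] by (simp add: regular_def)
  qed
  ultimately show "regular (Suc n)"
    using reg new occ by (auto simp: regular_def less_Suc_eq)
qed

text \<open>Sets of at most one old bit are all used, so the term has at least two bits; three bits
  would be all free ones and properly contain \<open>S\<close>. The premise of the last conclusion
  is the new instance of the final clause of \<open>regular\<close>, left to the caller.\<close>

lemma regular_pair:
  assumes reg: "regular (2 * i + 1)"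
    and all: "card (free_from (Suc i) (2 * i + 1)) \<le> 3"
    and S: "S \<subseteq> free_from (Suc i) (2 * i + 1)" "card S = 2" "\<not> used (2 * i + 1) S"
  shows "card (term_bits (2 * i + 1)) = 2"
    and "term_bits (2 * i + 1) \<subseteq> free_from (Suc i) (2 * i + 1)"
    and "free_from (Suc i) (2 * i + 2) = free_from (Suc i) (2 * i + 1) - term_bits (2 * i + 1)"
    and "(card (term_bits i) = 1 \<Longrightarrow> term_bits i \<subseteq> term_bits (2 * i + 1)) \<Longrightarrow> regular (2 * i + 2)"
proof -
  define n where "n = 2 * i + 1"
  define F where "F = free_from (Suc i) n"
  note defs = n_def[symmetric] F_def[symmetric]
  have window: "n \<le> 2 * Suc i" "2 * Suc i \<le> n + 1"
    by (simp_all add: n_def)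
  obtain k where occ: "occurring n = {..<k}"
    using reg by (auto simp: regular_def n_def)
  have sub: "term_bits n \<subseteq> F" and min: "\<not> S \<subset> term_bits n"
    using term_reuses_bits[OF window occ] S by (simp_all add: n_def F_def)
  have F_occ: "F \<subseteq> occurring n"
    by (auto simp: F_def free_from_def)
  have "\<not> used n (term_bits n)"
    by (rule not_used_term_self)
  then have "2 \<le> card (term_bits n)"
    using regular_used_small[of n "term_bits n"] reg sub F_occ by (force simp: n_def)
  moreover have "card (term_bits n) \<le> card F"
    using sub by (intro card_mono) (simp_all add: F_def)
  moreover have "card (term_bits n) \<noteq> 3"
  proof
    assume "card (term_bits n) = 3"
    then have "term_bits n = F"
      using sub all by (intro card_seteq) (auto simp: F_def n_def)
    then have "S \<subseteq> term_bits n" "S \<noteq> term_bits n"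
      using S \<open>card (term_bits n) = 3\<close> by (auto simp: F_def n_def)
    then show False
      using min by blast
  qed
  ultimately have card: "card (term_bits n) = 2"
    using all by (simp add: defs F_def n_def)
  have free: "free_from (Suc i) (Suc n) = F - term_bits n"
  proof (cases "Suc i \<le> n")
    case True
    then show ?thesis
      using sub F_occ by (auto simp: free_from_Suc F_def)
  next
    case False
    then have "i = 0" by (simp add: n_def)
    then have "occurring n = {}"
      by (simp add: n_def occurring_def)
    then show ?thesis
      using sub F_occ card by auto
  qed
  have reg': "regular (Suc n)" if *: "card (term_bits i) = 1 \<Longrightarrow> term_bits i \<subseteq> term_bits n"
  proof -
    have occ': "occurring (Suc n) = occurring n"
      using sub F_occ by (auto simp: occurring_Suc)
    have c: "term_bits n \<noteq> {y}" for y
      using card by auto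
    have "used (Suc n) {j}" if "j \<in> occurring n" for j
      using reg that used_mono[of n "{j}" "Suc n"] by (simp add: regular_def n_def)
    moreover have "odd n"
      by (simp add: n_def)
    ultimately show ?thesis
      using reg * unfolding defs regular_def occ' less_Suc_eq
      by (auto simp: c) (auto simp: n_def)
  qed
  show "card (term_bits (2 * i + 1)) = 2"
    and "term_bits (2 * i + 1) \<subseteq> free_from (Suc i) (2 * i + 1)"
    using card sub unfolding n_def F_def by simp_all
  show "free_from (Suc i) (2 * i + 2) = free_from (Suc i) (2 * i + 1) - term_bits (2 * i + 1)"
    using free by (simp add: F_def n_def)
  show "regular (2 * i + 2)" if "card (term_bits i) = 1 \<Longrightarrow> term_bits i \<subseteq> term_bits (2 * i + 1)"
    using reg' that by (simp add: n_def)
qed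

text \<open>
  \<open>L\<close> is the set of old bits that are already free before step \<open>2 * m + 1\<close>, where the bits of
  term \<open>m\<close> become free as well.
\<close>

definition stage :: "nat \<Rightarrow> nat set \<Rightarrow> bool" where
  "stage m L \<longleftrightarrow> regular (2 * m + 1) \<and> free_from m (2 * m + 1) = L"

section \<open>Transitions of the automaton\<close>

lemma stage_free:
  assumes "stage m L"
  shows "free_from (Suc m) (2 * m + 1) = L \<union> term_bits m" "L \<inter> term_bits m = {}"
  using free_from_drop[of m "2 * m + 1"] term_bits_disjoint[of m] assms
  by (auto simp: stage_def)

text \<open>Indices \<open>2 * m + 1\<close> and \<open>2 * m + 2\<close> share the window start
  \<open>Suc m\<close>, so nothing leaves the window at the even index; with all free sets used, the
  term is a new bit and \<open>L\<close> stays.\<close>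

lemma stage_Suc:
  assumes "regular (2 * m + 2)" "free_from (Suc m) (2 * m + 2) = L"
    and "\<And>S. S \<subseteq> L \<Longrightarrow> used (2 * m + 2) S"
  shows "stage (Suc m) L"
  using regular_new[of "2 * m + 2" "Suc m"] assms by (simp add: stage_def)

lemma stage_even: "stage m L \<Longrightarrow> 0 < m \<Longrightarrow> card (term_bits (2 * m)) = 1"
  by (simp add: stage_def regular_def)

lemma subsets_used:
  assumes "regular n" "L \<subseteq> occurring n" "used n L" "card L \<le> 2" "S \<subseteq> L"
  shows "used n S"
proof (cases "S = L")
  case False
  then have "S \<subset> L" using assms by auto
  moreover have "finite L"
    using assms(2) by (rule finite_subset) simp
  ultimately have "card S < card L"
    by (metis psubset_card_mono)
  then show ?thesis
    using assms by (intro regular_used_small) auto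
qed (use assms in simp)

text \<open>With nothing left over, the free bits are those of term \<open>m\<close>. That set is
  used by term \<open>m\<close> itself and its proper subsets have at most one bit, so a new bit is
  forced.\<close>

lemma stage_new:
  assumes st: "stage m {}" and card: "card (term_bits m) \<le> 2"
  shows "stage (Suc m) (term_bits m)" "card (term_bits (2 * m + 1)) = 1"
proof -
  have reg: "regular (2 * m + 1)"
    using st by (simp add: stage_def)
  have free: "free_from (Suc m) (2 * m + 1) = term_bits m"
    using stage_free[OF st] by simp
  have all_used: "used (2 * m + 1) S" if "S \<subseteq> term_bits m" for S
  proof (rule subsets_used[OF reg _ _ card that])
    show "term_bits m \<subseteq> occurring (2 * m + 1)"
      unfolding occurring_def by (rule UN_upper) simp
  qed (simp add: used_term)
  have window: "2 * m + 1 \<le> 2 * Suc m" "2 * Suc m \<le> 2 * m + 1 + 1"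
    by simp_all
  note new = regular_new[OF reg window, unfolded free, OF all_used]
  show "card (term_bits (2 * m + 1)) = 1"
    using new(2) .
  show "stage (Suc m) (term_bits m)"
  proof (rule stage_Suc)
    show "used (2 * m + 2) S" if "S \<subseteq> term_bits m" for S
      using all_used[OF that] by (rule used_mono) simp
  qed (use new(1,3) in simp_all)
qed

text \<open>After a pair at most one free bit remains, so all free sets are used again and
  \<open>stage_Suc\<close> handles the following even index.\<close>

lemma stage_after_pair:
  assumes st: "stage m L"
    and all: "card (L \<union> term_bits m) \<le> 3"
    and S: "S \<subseteq> L \<union> term_bits m" "card S = 2" "\<not> used (2 * m + 1) S"
    and keep: "card (term_bits m) = 1 \<Longrightarrow> term_bits m \<subseteq> term_bits (2 * m + 1)"
  shows "stage (Suc m) (L \<union> term_bits m - term_bits (2 * m + 1))"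
    "card (L \<union> term_bits m - term_bits (2 * m + 1)) = card (L \<union> term_bits m) - 2"
    "card (term_bits (2 * m + 1)) = 2"
    "term_bits (2 * m + 1) \<subseteq> L \<union> term_bits m"
proof -
  have reg: "regular (2 * m + 1)"
    using st by (simp add: stage_def)
  note free = stage_free(1)[OF st]
  note pair = regular_pair[OF reg, unfolded free, OF all S]
  show card2: "card (term_bits (2 * m + 1)) = 2" 
    and sub: "term_bits (2 * m + 1) \<subseteq> L \<union> term_bits m"
    using pair by simp_all
  then show rest: "card (L \<union> term_bits m - term_bits (2 * m + 1)) = card (L \<union> term_bits m) - 2"
    by (simp add: card_Diff_subset)
  have reg2: "regular (2 * m + 2)"
    using pair(4) keep by simp
  let ?L = "L \<union> term_bits m - term_bits (2 * m + 1)"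
  have L: "finite ?L" "?L \<subseteq> occurring (2 * m + 2)"
    using pair(3) by (metis finite_free_from, metis free_from_def Diff_subset)
  show "stage (Suc m) ?L"
  proof (rule stage_Suc[OF reg2 pair(3)])
    fix T assume T: "T \<subseteq> ?L"
    have "card T \<le> card ?L"
      using L(1) T by (rule card_mono)
    with rest all have "card T \<le> 1"
      by simp
    with reg2 show "used (2 * m + 2) T"
      using L(2) T by (intro regular_used_small) auto
  qed
qed

lemma stage_pair:
  assumes st: "stage m L" and L: "card L = 1" and card: "card (term_bits m) = 1"
  shows "stage (Suc m) {}" "card (term_bits (2 * m + 1)) = 2"
proof -
  have reg: "regular (2 * m + 1)"
    using st by (simp add: stage_def)
  obtain y where y: "term_bits m = {y}"
    using card by (rule card_1_singletonE)
  obtain x where x: "L = {x}"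
    using L by (rule card_1_singletonE)
  have "x \<noteq> y"
    using stage_free(2)[OF st] x y by auto
  have unused: "\<not> used (2 * m + 1) {x, y}"
  proof
    assume "used (2 * m + 1) {x, y}"
    then obtain i where "i < 2 * m + 1" "term_bits i = {x, y}"
      by (auto simp: used_def)
    moreover from this have "i = m"
      using regular_single_recurs[OF reg _ y, of i] by auto
    ultimately show False
      using y \<open>x \<noteq> y\<close> by auto
  qed
  have all: "L \<union> term_bits m = {x, y}" "card {x, y} = 2"
    using x y \<open>x \<noteq> y\<close> by auto
  have all_sub: "{x, y} \<subseteq> term_bits (2 * m + 1)"
  proof -
    have free: "free_from (Suc m) (2 * m + 1) = {x, y}"
      using stage_free(1)[OF st] all by simp
    have "card (term_bits (2 * m + 1)) = 2" "term_bits (2 * m + 1) \<subseteq> {x, y}"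
      using regular_pair(1,2)[OF reg, unfolded free, of "{x, y}"] unused all by simp_all
    then have "term_bits (2 * m + 1) = {x, y}"
      using all by (intro card_subset_eq) auto
    then show ?thesis by simp
  qed
  have "L \<union> term_bits m - term_bits (2 * m + 1) = {}"
    using all all_sub by auto
  then show "stage (Suc m) {}" "card (term_bits (2 * m + 1)) = 2"
    using stage_after_pair(1,3)[OF st, unfolded all(1), OF _ _ all(2) unused] all y all_sub by simp_all
qed

text \<open>Which pair is chosen is left open. Since the pair avoiding \<open>x\<close> is used, the
  chosen one contains \<open>x\<close>, and one bit remains either way. \<open>single\<close>
  preserves the last clause of \<open>regular\<close>.\<close>

lemma stage_triple:
  assumes st: "stage m L"
    and all: "card (L \<union> term_bits m) = 3"
    and x: "x \<in> L \<union> term_bits m" "used (2 * m + 1) (L \<union> term_bits m - {x})"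
    and c: "c \<in> L \<union> term_bits m" "c \<noteq> x" "\<not> used (2 * m + 1) {x, c}"
    and single: "card (term_bits m) = 1 \<Longrightarrow> term_bits m = {x}"
  shows "\<exists>L'. stage (Suc m) L' \<and> card L' = 1" "card (term_bits (2 * m + 1)) = 2"
proof -
  have reg: "regular (2 * m + 1)"
    using st by (simp add: stage_def)
  note free = stage_free(1)[OF st]
  have S: "{x, c} \<subseteq> L \<union> term_bits m" "card {x, c} = 2"
    using x c by auto
  have card: "card (term_bits (2 * m + 1)) = 2" "term_bits (2 * m + 1) \<subseteq> L \<union> term_bits m"
    using regular_pair(1,2)[OF reg, unfolded free, OF _ S c(3)] all by simp_all
  have "x \<in> term_bits (2 * m + 1)"
  proof (rule ccontr)
    assume "x \<notin> term_bits (2 * m + 1)"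
    then have "term_bits (2 * m + 1) \<subseteq> L \<union> term_bits m - {x}"
      using card by auto
    moreover have "card (L \<union> term_bits m - {x}) = 2"
      using all x(1) by simp
    moreover have "finite (L \<union> term_bits m - {x})"
      using all card_ge_0_finite[of "L \<union> term_bits m"] by simp
    ultimately have "term_bits (2 * m + 1) = L \<union> term_bits m - {x}"
      using card(1) by (intro card_subset_eq) auto
    then show False
      using x(2) not_used_term_self[of "2 * m + 1"] by simp
  qed
  then have "term_bits m \<subseteq> term_bits (2 * m + 1)" if "card (term_bits m) = 1"
    using single[OF that] by simp
  note after = stage_after_pair(1,2)[OF st _ S c(3) this]
  show "\<exists>L'. stage (Suc m) L' \<and> card L' = 1"
    using after all by (intro exI[of _ "L \<union> term_bits m - term_bits (2 * m + 1)"]) simp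
  show "card (term_bits (2 * m + 1)) = 2"
    by (rule card(1))
qed

lemma stage_triple_pair_single:
  assumes st: "stage m L" and L: "card L = 2" "used (2 * m + 1) L" and card: "card (term_bits m) = 1"
  shows "\<exists>L'. stage (Suc m) L' \<and> card L' = 1" "card (term_bits (2 * m + 1)) = 2"
proof -
  have reg: "regular (2 * m + 1)"
    using st by (simp add: stage_def)
  obtain x where x: "term_bits m = {x}"
    using card by (rule card_1_singletonE)
  have x_L: "x \<notin> L"
    using stage_free(2)[OF st] x by auto
  have "finite L" "L \<noteq> {}"
    using L by (auto simp: card_ge_0_finite)
  then obtain c where c: "c \<in> L" by blast
  have "\<not> used (2 * m + 1) {x, c}"
  proof
    assume "used (2 * m + 1) {x, c}"
    then obtain i where "i < 2 * m + 1" "term_bits i = {x, c}"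
      by (auto simp: used_def)
    moreover from this have "i = m"
      using regular_single_recurs[OF reg _ x, of i] by auto
    ultimately show False
      using x x_L c by auto
  qed
  moreover have "card (L \<union> term_bits m) = 3"
    using x x_L L \<open>finite L\<close> by simp
  moreover have "used (2 * m + 1) (L \<union> term_bits m - {x})"
    using x x_L L(2) by simp
  moreover have "x \<in> L \<union> term_bits m" "c \<in> L \<union> term_bits m" "c \<noteq> x"
    using x x_L c by auto
  ultimately show "\<exists>L'. stage (Suc m) L' \<and> card L' = 1" "card (term_bits (2 * m + 1)) = 2"
    using stage_triple[OF st _ _ _ _ _ _ x] by blast+
qed

lemma stage_triple_single_pair:
  assumes st: "stage m {x}" and card: "card (term_bits m) = 2"
    and c: "c \<in> term_bits m" "\<not> used (2 * m + 1) {x, c}"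
  shows "\<exists>L'. stage (Suc m) L' \<and> card L' = 1" "card (term_bits (2 * m + 1)) = 2"
proof -
  have x: "x \<notin> term_bits m"
    using stage_free(2)[OF st] by auto
  then have "card ({x} \<union> term_bits m) = 3" "{x} \<union> term_bits m - {x} = term_bits m"
    using card by auto
  moreover have "used (2 * m + 1) (term_bits m)"
    by (simp add: used_term)
  moreover have "x \<in> {x} \<union> term_bits m" "c \<in> {x} \<union> term_bits m" "c \<noteq> x"
    using x c by auto
  moreover have "term_bits m = {x}" if "card (term_bits m) = 1"
    using that card by simp
  ultimately show "\<exists>L'. stage (Suc m) L' \<and> card L' = 1" "card (term_bits (2 * m + 1)) = 2"
    using stage_triple[OF st, of x c] c(2) by metis+
qed

lemma stage_triple_fresh:
  assumes st: "stage (Suc m) (term_bits m)"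
    and card: "card (term_bits m) = 1" "card (term_bits (2 * m + 1)) = 1" "card (term_bits (Suc m)) = 2"
  shows "\<exists>L'. stage (Suc (Suc m)) L' \<and> card L' = 1" "card (term_bits (2 * m + 3)) = 2"
proof -
  have reg: "regular (2 * m + 3)"
    using st by (simp add: stage_def numeral_3_eq_3)
  obtain x where x: "term_bits m = {x}"
    using card(1) by (rule card_1_singletonE)
  have "term_bits (Suc m) \<noteq> {}"
    using card by auto
  then obtain c where c: "c \<in> term_bits (Suc m)" by blast
  have "x \<noteq> c"
    using stage_free(2)[OF st] x c by auto
  then have card_xc: "card {x, c} = 2" by simp
  have "\<not> used (2 * m + 3) {x, c}"
  proof
    assume "used (2 * m + 3) {x, c}"
    then obtain i where i: "i < 2 * m + 3" "term_bits i = {x, c}"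
      by (auto simp: used_def)
    \<comment> \<open>Up to \<open>2 * m\<close> the window of term \<open>m\<close> isolates its
      bit \<open>x\<close>; the two later indices carry terms of weight 1, so neither is a
      pair.\<close>
    have "i \<le> 2 * m \<or> i = 2 * m + 1 \<or> i = 2 * Suc m"
      using i(1) by presburger
    then consider "i \<le> 2 * m" | "i = 2 * m + 1" | "i = 2 * Suc m"
      by blast
    then show False
    proof cases
      case 1
      then have "i = m"
        using regular_single_recurs[OF reg _ x, of i] i(2) by auto
      then show False
        using card(1) i(2) card_xc by simp
    next
      case 2
      then show False
        using card(2) i(2) card_xc by simp
    next
      case 3
      then show False
        using stage_even[OF st] i(2) card_xc by simp
    qed
  qed
  then show "\<exists>L'. stage (Suc (Suc m)) L' \<and> card L' = 1" "card (term_bits (2 * m + 3)) = 2"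
    using stage_triple_single_pair[of "Suc m" x c] st x c card by (simp_all add: numeral_3_eq_3)
qed

text \<open>
  The bit of term \<open>i\<close> has occurred in no pair other than term \<open>m\<close>, so its pair with the left-over bit
  is new.
\<close>

lemma stage_triple_old:
  assumes st: "stage m L" and L: "card L = 1" and card: "card (term_bits m) = 2"
    and i: "m = 2 * i + 1" "card (term_bits i) = 1"
  shows "\<exists>L'. stage (Suc m) L' \<and> card L' = 1" "card (term_bits (2 * m + 1)) = 2"
proof -
  have reg: "regular (2 * m + 1)"
    using st by (simp add: stage_def)
  obtain x where x: "L = {x}"
    using L by (rule card_1_singletonE)
  obtain c where c: "term_bits i = {c}"
    using i(2) by (rule card_1_singletonE)
  have "term_bits i \<subseteq> term_bits m"
    using reg i card by (simp add: regular_def)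
  then have cm: "c \<in> term_bits m"
    using c by simp
  have xm: "x \<notin> term_bits m"
    using stage_free(2)[OF st] x by auto
  have "\<not> used (2 * m + 1) {x, c}"
  proof
    assume "used (2 * m + 1) {x, c}"
    then obtain j where j: "j < 2 * m + 1" "term_bits j = {x, c}"
      by (auto simp: used_def)
    \<comment> \<open>Up to \<open>2 * i = m - 1\<close> the freshness of \<open>c\<close> decides;
      from \<open>m + 1\<close> to \<open>2 * m\<close> the window of term \<open>m\<close>
      does.\<close>
    consider "j \<le> 2 * i" | "j = m" | "m < j" "j \<le> 2 * m"
      using j(1) i(1) by linarith
    then show False
    proof cases
      case 1
      then have "j = i"
        using regular_single_recurs[OF reg _ c, of j] i(1) j(2) by auto
      then show False
        using xm cm j(2) c by auto
    next
      case 2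
      then show False
        using j(2) xm by simp
    next
      case 3
      then show False
        using term_bits_disjoint[of m j] cm j(2) by auto
    qed
  qed
  then show "\<exists>L'. stage (Suc m) L' \<and> card L' = 1" "card (term_bits (2 * m + 1)) = 2"
    using stage_triple_single_pair[of m x c] st x cm card by simp_all
qed

subsection \<open>The weight pattern\<close>

lemma stage_0: "stage 0 {}"
  using regular_1 by (auto simp: stage_def free_from_def occurring_def)

lemma stage_even_index: "stage m L \<Longrightarrow> 0 < i \<Longrightarrow> even i \<Longrightarrow> i \<le> 2 * m \<Longrightarrow> card (term_bits i) = 1"
  by (simp add: stage_def regular_def)

abbreviation stage1 :: "nat \<Rightarrow> bool" where
  "stage1 m \<equiv> \<exists>L. stage m L \<and> card L = 1"

text \<open>The automaton is run by hand up to \<open>m = 12\<close>. This supplies the start of the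
  later induction and the sporadic indices below 24.\<close>

lemma initial_terms:
  "stage1 12"
  "card (term_bits 1) = 1" "card (term_bits 3) = 1" "card (term_bits 5) = 2"
  "card (term_bits 7) = 1" "card (term_bits 9) = 2" "card (term_bits 11) = 1"
  "card (term_bits 13) = 2" "card (term_bits 15) = 2" "card (term_bits 17) = 1"
  "card (term_bits 19) = 2" "card (term_bits 21) = 2" "card (term_bits 23) = 1"
proof -
  have "stage 1 {}" and c1: "card (term_bits 1) = 1"
    using stage_new[OF stage_0] by simp_all
  from stage_new[OF this(1)] this(2)
  have st2: "stage 2 (term_bits 1)" and c3: "card (term_bits 3) = 1"
    by (simp_all add: numeral_2_eq_2 numeral_3_eq_3)
  have c2: "card (term_bits 2) = 1"
    using stage_even_index[OF st2, of 2] by simp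
  have st3: "stage 3 {}" and c5: "card (term_bits 5) = 2"
    using stage_pair[OF st2 c1 c2] by simp_all
  have st4: "stage 4 (term_bits 3)" and c7: "card (term_bits 7) = 1"
    using stage_new[OF st3] c3 by simp_all
  have c4: "card (term_bits 4) = 1"
    using stage_even_index[OF st4, of 4] by simp
  have st5: "stage 5 {}" and c9: "card (term_bits 9) = 2"
    using stage_pair[OF st4 c3 c4] by simp_all
  have st6: "stage 6 (term_bits 5)" and c11: "card (term_bits 11) = 1"
    using stage_new[OF st5] c5 by simp_all
  have c6: "card (term_bits 6) = 1"
    using stage_even_index[OF st6, of 6] by simp
  have "stage1 7" and c13: "card (term_bits 13) = 2"
    using stage_triple_pair_single[OF st6 c5 _ c6] used_term[of 5 13] by simp_all
  then obtain L7 where L7: "stage 7 L7" "card L7 = 1" by blast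
  have st8: "stage 8 {}" and c15: "card (term_bits 15) = 2"
    using stage_pair[OF L7 c7] by simp_all
  have c8: "card (term_bits 8) = 1"
    using stage_even_index[OF st8, of 8] by simp
  have st9: "stage 9 (term_bits 8)" and c17: "card (term_bits 17) = 1"
    using stage_new[OF st8] c8 by simp_all
  have "stage1 10" and c19: "card (term_bits 19) = 2"
    using stage_triple_fresh[of 8] st9 c8 c17 c9 by simp_all
  then obtain L10 where L10: "stage 10 L10" "card L10 = 1" by blast
  have c10: "card (term_bits 10) = 1"
    using stage_even_index[OF L10(1), of 10] by simp
  have st11: "stage 11 {}" and c21: "card (term_bits 21) = 2"
    using stage_pair[OF L10 c10] by simp_all
  have st12: "stage 12 (term_bits 11)" and c23: "card (term_bits 23) = 1"
    using stage_new[OF st11] c11 by simp_all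
  show "stage1 12"
    using st12 c11 by blast
  show "card (term_bits 1) = 1" "card (term_bits 3) = 1" "card (term_bits 5) = 2"
    "card (term_bits 7) = 1" "card (term_bits 9) = 2" "card (term_bits 11) = 1"
    "card (term_bits 13) = 2" "card (term_bits 15) = 2" "card (term_bits 17) = 1"
    "card (term_bits 19) = 2" "card (term_bits 21) = 2" "card (term_bits 23) = 1"
    by fact+
qed

text \<open>
  The odd-indexed terms \<open>6 * h + 1\<close>, \<open>6 * h + 3\<close>, \<open>6 * h + 5\<close> have weights 2, 1, 2, except just before
  the indices \<open>18 * 2 ^ k\<close> and \<open>24 * 2 ^ k\<close>, where the weights are 2, 2, 1.
\<close>

definition exceptional :: "nat \<Rightarrow> bool" where
  "exceptional h \<longleftrightarrow> (\<exists>k. h + 1 = 3 * 2 ^ k \<or> h + 1 = 4 * 2 ^ k)"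

text \<open>\<open>2 * h + 1\<close> is odd and at least 5, whereas 3 is the only odd value among
  \<open>3 * 2 ^ k\<close> and \<open>4 * 2 ^ k\<close>.\<close>

lemma exceptional_double:
  assumes "2 \<le> h"
  shows "\<not> exceptional (2 * h)"
proof
  assume "exceptional (2 * h)"
  then obtain k where k: "2 * h + 1 = 3 * 2 ^ k \<or> 2 * h + 1 = 4 * 2 ^ k"
    by (auto simp: exceptional_def)
  show False
  proof (cases k)
    case 0
    with k assms show ?thesis by auto
  next
    case (Suc j)
    with k have "2 * h + 1 = 2 * (3 * 2 ^ j) \<or> 2 * h + 1 = 2 * (4 * 2 ^ j)" by auto
    then have "even (2 * h + 1)" by (metis dvd_triv_left)
    then show ?thesis by simp
  qed
qed

lemma exceptional_double_Suc:
  assumes "2 \<le> h"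
  shows "exceptional (2 * h + 1) \<longleftrightarrow> exceptional h"
proof
  assume "exceptional (2 * h + 1)"
  then obtain k where k: "2 * h + 2 = 3 * 2 ^ k \<or> 2 * h + 2 = 4 * 2 ^ k"
    by (auto simp: exceptional_def)
  with assms obtain j where "k = Suc j"
    by (cases k) auto
  with k have "h + 1 = 3 * 2 ^ j \<or> h + 1 = 4 * 2 ^ j"
    by auto
  then show "exceptional h"
    unfolding exceptional_def by blast
next
  assume "exceptional h"
  then obtain k where "h + 1 = 3 * 2 ^ k \<or> h + 1 = 4 * 2 ^ k"
    unfolding exceptional_def by blast
  then have "(2 * h + 1) + 1 = 3 * 2 ^ Suc k \<or> (2 * h + 1) + 1 = 4 * 2 ^ Suc k"
    by auto
  then show "exceptional (2 * h + 1)"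
    unfolding exceptional_def by blast
qed

lemma exceptional_2: "exceptional 2" and exceptional_3: "exceptional 3"
  unfolding exceptional_def by (auto intro!: exI[of _ 0])

definition pattern :: "nat \<Rightarrow> bool" where
  "pattern h \<longleftrightarrow> card (term_bits (6 * h + 1)) = 2
     \<and> card (term_bits (6 * h + 3)) = (if exceptional h then 2 else 1)
     \<and> card (term_bits (6 * h + 5)) = (if exceptional h then 1 else 2)"

lemma pattern_2_3: "pattern 2" "pattern 3"
  using initial_terms by (simp_all add: pattern_def exceptional_2 exceptional_3)

text \<open>Steps \<open>m = 6 * q\<close> to \<open>6 * q + 5\<close> decide the odd indices
  \<open>12 * q + 1\<close> to \<open>12 * q + 11\<close>. They read the weights of terms
  \<open>6 * q\<close> to \<open>6 * q + 5\<close>: 1 at even indices, given by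
  \<open>pattern q\<close> at odd ones. The number of left-over bits runs 1, 0, 2, 1, then 0, 1, 1,
  or 1, 0, 1 if \<open>q\<close> is exceptional.\<close>

lemma block_step:
  assumes q: "2 \<le> q" and st0: "stage1 (6 * q)" and pat: "pattern q"
  shows "stage1 (6 * (q + 1))" "pattern (2 * q)" "pattern (2 * q + 1)"
proof -
  define m where "m = 6 * q"
  obtain L0 where L0: "stage m L0" "card L0 = 1"
    using st0 by (auto simp: m_def)
  have ev: "card (term_bits i) = 1" if "0 < i" "even i" "i \<le> 2 * m" for i
    using stage_even_index[OF L0(1)] that by blast
  have "even m" "0 < m" "4 \<le> m"
    using q by (simp_all add: m_def)
  have w: "card (term_bits m) = 1" "card (term_bits (m + 2)) = 1" "card (term_bits (m + 4)) = 1"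
    using \<open>even m\<close> \<open>0 < m\<close> \<open>4 \<le> m\<close> by (simp_all add: ev)
  have w1: "card (term_bits (m + 1)) = 2"
    and w3: "card (term_bits (m + 3)) = (if exceptional q then 2 else 1)"
    and w5: "card (term_bits (m + 5)) = (if exceptional q then 1 else 2)"
    using pat by (simp_all add: pattern_def m_def)
  have st1: "stage (m + 1) {}" and c1: "card (term_bits (2 * m + 1)) = 2"
    using stage_pair[OF L0 w(1)] by simp_all
  have st2: "stage (m + 2) (term_bits (m + 1))" and c3: "card (term_bits (2 * m + 3)) = 1"
    using stage_new[OF st1] w1 by (simp_all add: numeral_3_eq_3)
  have "used (2 * (m + 2) + 1) (term_bits (m + 1))"
    by (rule used_term) simp
  from stage_triple_pair_single[OF st2 w1 this w(2)]
  have "stage1 (m + 3)" and c5: "card (term_bits (2 * m + 5)) = 2"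
    by (simp_all add: eval_nat_numeral)
  then obtain L3 where L3: "stage (m + 3) L3" "card L3 = 1" by blast
  have "stage1 (m + 6) \<and> card (term_bits (2 * m + 7)) = 2
      \<and> card (term_bits (2 * m + 9)) = (if exceptional q then 2 else 1)
      \<and> card (term_bits (2 * m + 11)) = (if exceptional q then 1 else 2)"
  proof (cases "exceptional q")
    case True
    \<comment> \<open>\<open>stage_triple_old\<close> requires term \<open>3 * q + 1\<close> to have
      weight 1. Its index is even when \<open>q\<close> is odd; the only even exceptional
      \<open>q \<ge> 2\<close> is 2, which leads to term 7.\<close>
    have i: "m + 3 = 2 * (3 * q + 1) + 1"
      by (simp add: m_def)
    have w_i: "card (term_bits (3 * q + 1)) = 1"
    proof (cases "q = 2")
      case True
      then show ?thesis using initial_terms(5) by simp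
    next
      case False
      have "odd q"
      proof
        assume "even q"
        then obtain h where "q = 2 * h" ..
        with q False exceptional_double[of h] True show False by auto
      qed
      then show ?thesis
        using q by (intro ev) (auto simp: m_def)
    qed
    from stage_triple_old[OF L3 _ i w_i] w3 True
    have "stage1 (m + 4)" and c7: "card (term_bits (2 * m + 7)) = 2"
      by (simp_all add: eval_nat_numeral)
    then obtain L4 where L4: "stage (m + 4) L4" "card L4 = 1" by blast
    from stage_pair[OF L4 w(3)]
    have st5: "stage (m + 5) {}" and c9: "card (term_bits (2 * m + 9)) = 2"
      by (simp_all add: eval_nat_numeral)
    from stage_new[OF st5] w5 True
    have "stage (m + 6) (term_bits (m + 5))" and c11: "card (term_bits (2 * m + 11)) = 1"
      by (simp_all add: eval_nat_numeral)
    then show ?thesis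
      using c7 c9 w5 True by auto
  next
    case False
    with w3 w5 have w3: "card (term_bits (m + 3)) = 1" and w5: "card (term_bits (m + 5)) = 2"
      by simp_all
    from stage_pair[OF L3 w3]
    have st4: "stage (m + 4) {}" and c7: "card (term_bits (2 * m + 7)) = 2"
      by (simp_all add: eval_nat_numeral)
    from stage_new[OF st4] w(3)
    have st5: "stage (Suc (m + 4)) (term_bits (m + 4))" and c9: "card (term_bits (2 * m + 9)) = 1"
      by (simp_all add: eval_nat_numeral)
    \<comment> \<open>The left-over bit is that of term \<open>m + 4\<close>, and term
      \<open>2 * (m + 4) + 1\<close> has weight 1, so this bit is in no pair yet.\<close>
    from stage_triple_fresh[OF st5 w(3)] c9 w5
    have "stage1 (m + 6)" and c11: "card (term_bits (2 * m + 11)) = 2"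
      by (simp_all add: eval_nat_numeral)
    then show ?thesis
      using c7 c9 False by simp
  qed
  then show "stage1 (6 * (q + 1))" "pattern (2 * q)" "pattern (2 * q + 1)"
    using c1 c3 c5 exceptional_double[OF q] exceptional_double_Suc[OF q]
    by (auto simp: pattern_def m_def algebra_simps)
qed

text \<open>The induction feeds itself: step \<open>q\<close> reads \<open>pattern q\<close>, known
  already because \<open>q < 2 * q\<close>, and yields the patterns at \<open>2 * q\<close> and
  \<open>2 * q + 1\<close>.\<close>

lemma stage1_and_pattern:
  "2 \<le> q \<Longrightarrow> stage1 (6 * q) \<and> (\<forall>h. 2 \<le> h \<and> h < 2 * q \<longrightarrow> pattern h)"
proof (induction q rule: dec_induct)
  case base
  have "pattern h" if "2 \<le> h" "h < 4" for h
  proof -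
    have "h = 2 \<or> h = 3" using that by linarith
    then show ?thesis using pattern_2_3 by auto
  qed
  then show ?case
    using initial_terms(1) by simp
next
  case (step q)
  have "pattern q"
    using step by simp
  note block = block_step[OF step(1) conjunct1[OF step(3)] this]
  have "pattern h" if "2 \<le> h" "h < 2 * Suc q" for h
  proof (cases "h < 2 * q")
    case True
    then show ?thesis using step that by blast
  next
    case False
    then have "h = 2 * q \<or> h = 2 * q + 1" using that by presburger
    then show ?thesis using block by blast
  qed
  then show ?case
    using block(1) by simp
qed

lemma pattern_holds: "2 \<le> h \<Longrightarrow> pattern h"
  using stage1_and_pattern[of h] by simp

section \<open>The index set of the weight-2 terms\<close>

lemma card_even_term:
  assumes "0 < i" "even i"
  shows "card (term_bits i) = 1"
proof -
  obtain L where "stage (6 * (i + 2)) L"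
    using stage1_and_pattern[of "i + 2"] by auto
  then show ?thesis
    using assms by (intro stage_even_index) auto
qed

text \<open>For \<open>q \<ge> 2\<close> this merges the patterns at \<open>2 * q\<close>, never
  exceptional, and at \<open>2 * q + 1\<close>, exceptional exactly when \<open>q\<close>
  is.\<close>

definition block_indices :: "nat \<Rightarrow> nat set" where
  "block_indices q =
     {12 * q + 1, 12 * q + 5, 12 * q + 7, if exceptional q then 12 * q + 9 else 12 * q + 11}"

lemma block_indices_div: "n \<in> block_indices q \<Longrightarrow> n div 12 = q"
  by (auto simp: block_indices_def split: if_splits)

lemma weight2_indices_iff: "n \<in> weight2_indices \<longleftrightarrow> card (term_bits n) = 2"
  by (simp add: weight2_indices_def weight_eq)

lemma odd_mod_12_cases:
  assumes "odd (n :: nat)"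
  obtains q r where "n = 12 * q + r" "r \<in> {1, 3, 5, 7, 9, 11}"
proof
  show "n = 12 * (n div 12) + n mod 12"
    by simp
  have "odd (n mod 12)"
    using assms by presburger
  moreover have "n mod 12 < 12"
    by simp
  ultimately show "n mod 12 \<in> {1, 3, 5, 7, 9, 11}"
    by (simp only: insert_iff empty_iff) presburger
qed

lemma weight2_in_block:
  assumes "2 \<le> q" "r \<in> {1, 3, 5, 7, 9, 11}"
  shows "12 * q + r \<in> weight2_indices \<longleftrightarrow> 12 * q + r \<in> block_indices q"
  using assms(2) pattern_holds[of "2 * q"] pattern_holds[of "2 * q + 1"] assms(1)
    exceptional_double[of q] exceptional_double_Suc[of q]
  by (auto simp: pattern_def weight2_indices_iff block_indices_def algebra_simps)

lemma weight2_indices_eq: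
  "weight2_indices = {5, 9, 13, 15, 19, 21} \<union> (\<Union>q\<in>{2..}. block_indices q)"
proof (rule set_eqI)
  fix n
  show "n \<in> weight2_indices \<longleftrightarrow> n \<in> {5, 9, 13, 15, 19, 21} \<union> (\<Union>q\<in>{2..}. block_indices q)"
  proof (cases "even n")
    case True
    then have "card (term_bits n) \<noteq> 2"
      using card_even_term[of n] by (cases "n = 0") auto
    moreover have "n \<notin> block_indices q" for q
      using True by (auto simp: block_indices_def split: if_splits)
    ultimately show ?thesis
      using True by (auto simp: weight2_indices_iff)
  next
    case False
    then obtain q r where n: "n = 12 * q + r" and r: "r \<in> {1, 3, 5, 7, 9, 11}"
      by (rule odd_mod_12_cases)
    have q: "n \<in> block_indices p \<Longrightarrow> p = q" for p
      using block_indices_div[of n p] n r by auto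
    show ?thesis
    proof (cases "2 \<le> q")
      case True
      have "n \<notin> {5, 9, 13, 15, 19, 21}"
        using True n by auto
      then show ?thesis
        using weight2_in_block[OF True r] q True n by auto
    next
      case False
      then have "q = 0 \<or> q = 1" by linarith
      moreover have "n \<notin> (\<Union>q\<in>{2..}. block_indices q)"
        using q False by auto
      ultimately show ?thesis
        using r initial_terms unfolding n weight2_indices_iff by auto
    qed
  qed
qed

lemma infinite_weight2_indices: "infinite weight2_indices"
proof -
  have "(\<lambda>q. 12 * q + 1) ` {2..} \<subseteq> weight2_indices"
    by (auto simp: weight2_indices_eq block_indices_def)
  moreover have "infinite ((\<lambda>q::nat. 12 * q + 1) ` {2..})"
    by (subst finite_image_iff) (auto simp: inj_on_def infinite_Ici)
  ultimately show ?thesis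
    using finite_subset by blast
qed

subsection \<open>Generating functions\<close>

definition fps_indicator :: "nat set \<Rightarrow> 'a::comm_ring_1 fps" where
  "fps_indicator S = Abs_fps (\<lambda>n. if n \<in> S then 1 else 0)"

lemma fps_indicator_nth [simp]: "fps_nth (fps_indicator S) n = (if n \<in> S then 1 else 0)"
  by (simp add: fps_indicator_def)

lemma fps_indicator_empty: "fps_indicator {} = 0"
  by (rule fps_ext) simp

lemma fps_indicator_insert:
  "n \<notin> S \<Longrightarrow> fps_indicator (insert n S) = fps_X ^ n + fps_indicator S"
  by (rule fps_ext) auto

lemma fps_indicator_singleton: "fps_indicator {n} = fps_X ^ n"
  by (simp add: fps_indicator_insert fps_indicator_empty)

lemma fps_indicator_Un:
  "A \<inter> B = {} \<Longrightarrow> fps_indicator (A \<union> B) = fps_indicator A + fps_indicator B"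
  by (rule fps_ext) auto

lemma fps_indicator_UN:
  assumes "finite I" "disjoint_family_on S I"
  shows "fps_indicator (\<Union>i\<in>I. S i) = (\<Sum>i\<in>I. fps_indicator (S i))"
  using assms
proof (induction I)
  case empty
  show ?case by (simp add: fps_indicator_empty)
next
  case (insert i I)
  have "S i \<inter> (\<Union>j\<in>I. S j) = {}"
    using insert.prems insert.hyps by (fastforce simp: disjoint_family_on_def)
  moreover have "disjoint_family_on S I"
    using insert.prems by (auto simp: disjoint_family_on_def)
  ultimately show ?case
    using insert by (simp add: fps_indicator_Un)
qed

text \<open>Since \<open>S k\<close> has no element below \<open>k\<close>, coefficient
  \<open>n\<close> is settled after the first \<open>n + 1\<close> summands.\<close>

lemma fps_indicator_sums:
  assumes disj: "disjoint_family S" and le: "\<And>k n. n \<in> S k \<Longrightarrow> k \<le> n"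
  shows "(\<lambda>k. fps_indicator (S k) :: 'a::comm_ring_1 fps) sums fps_indicator (\<Union>k. S k)"
  unfolding sums_def
proof (rule tendsto_fpsI)
  fix n
  have "fps_nth (\<Sum>k<N. fps_indicator (S k) :: 'a fps) n = fps_nth (fps_indicator (\<Union>k. S k)) n"
    if "n < N" for N
  proof -
    have "disjoint_family_on S {..<N}"
      using disj by (auto simp: disjoint_family_on_def)
    moreover have "n \<in> (\<Union>k<N. S k) \<longleftrightarrow> n \<in> (\<Union>k. S k)"
      using le that by (auto intro: le_less_trans)
    ultimately show ?thesis
      by (simp flip: fps_indicator_UN)
  qed
  then show "\<forall>\<^sub>F N in sequentially.
      fps_nth (\<Sum>k<N. fps_indicator (S k) :: 'a fps) n = fps_nth (fps_indicator (\<Union>k. S k)) n"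
    by (intro eventually_sequentiallyI[of "Suc n"]) simp
qed

section \<open>Summation over dyadic ranges of blocks\<close>

lemma exceptional_in_dyadic_block:
  assumes "2 * 2 ^ j \<le> q" "q < 4 * 2 ^ j"
  shows "exceptional q \<longleftrightarrow> q + 1 = 3 * 2 ^ j \<or> q + 1 = 4 * 2 ^ j"
proof
  assume "exceptional q"
  then obtain k where k: "q + 1 = 3 * 2 ^ k \<or> q + 1 = 4 * 2 ^ k"
    by (auto simp: exceptional_def)
  \<comment> \<open>Values with \<open>k < j\<close> are at most \<open>2 * 2 ^ j\<close>, hence
    below \<open>q + 1\<close>; those with \<open>k > j\<close> are at least
    \<open>6 * 2 ^ j\<close>, beyond the range.\<close>
  consider "k < j" | "k = j" | "j < k" by linarith
  then show "q + 1 = 3 * 2 ^ j \<or> q + 1 = 4 * 2 ^ j"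
  proof cases
    case 1
    then have "(2::nat) ^ Suc k \<le> 2 ^ j"
      by (intro power_increasing) auto
    then show ?thesis using assms k by auto
  next
    case 3
    then have "(2::nat) ^ Suc j \<le> 2 ^ k"
      by (intro power_increasing) auto
    moreover have "0 < (2::nat) ^ j" by simp
    ultimately show ?thesis using assms k unfolding power_Suc by linarith
  qed (use k in simp)
qed (auto simp: exceptional_def)

lemma fps_indicator_block_indices:
  "fps_indicator (block_indices q) = fps_X ^ (12 * q + 1) * (if exceptional q then P_XU else P_VW)"
  by (simp add: block_indices_def fps_indicator_insert fps_indicator_empty P_XU_def P_VW_def
      distrib_left power_add[symmetric] add_ac del: power_Suc)

lemma fps_X_geometric_sum:
  "(\<Sum>i<c. (fps_X :: 'a::field fps) ^ (d * i)) = (1 - fps_X ^ (d * c)) / (1 - fps_X ^ d)" if "0 < d"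
proof -
  have "(1 - fps_X ^ d) * (\<Sum>i<c. ((fps_X :: 'a fps) ^ d) ^ i) = 1 - (fps_X ^ d) ^ c"
    by (rule one_diff_power_eq[symmetric])
  moreover have "fps_nth (1 - fps_X ^ d :: 'a fps) 0 \<noteq> 0"
    using that by simp
  then have "1 - (fps_X :: 'a fps) ^ d \<noteq> 0"
    by (metis fps_zero_nth)
  ultimately show ?thesis
    by (metis (no_types, lifting) nonzero_mult_div_cancel_left power_mult sum.cong)
qed

text \<open>Consecutive blocks are shifted by 12. The \<open>c\<close> ordinary ones contribute
  \<open>P_VW\<close> times a geometric sum; the last one, exceptional, contributes
  \<open>P_XU\<close>.\<close>

lemma half_block_sum:
  assumes "\<And>i. i < c \<Longrightarrow> \<not> exceptional (b + i)" "exceptional (b + c)"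
  shows "(\<Sum>i<Suc c. fps_indicator (block_indices (b + i))) =
    fps_X ^ (12 * b + 1)
     * ((1 - fps_X ^ (12 * c)) / (1 - fps_X ^ 12) * P_VW + fps_X ^ (12 * c) * P_XU)"
proof -
  have "(\<Sum>i<c. fps_indicator (block_indices (b + i))) =
      (\<Sum>i<c. fps_X ^ (12 * b + 1) * (fps_X ^ (12 * i) * P_VW))"
    using assms(1) by (intro sum.cong) (simp_all add: fps_indicator_block_indices power_add algebra_simps)
  also have "\<dots> = fps_X ^ (12 * b + 1) * ((\<Sum>i<c. fps_X ^ (12 * i)) * P_VW)"
    by (simp add: sum_distrib_left sum_distrib_right)
  finally have "(\<Sum>i<Suc c. fps_indicator (block_indices (b + i))) =
      fps_X ^ (12 * b + 1) * ((\<Sum>i<c. fps_X ^ (12 * i)) * P_VW)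
      + fps_X ^ (12 * b + 1) * (fps_X ^ (12 * c) * P_XU)"
    using assms(2) by (simp add: fps_indicator_block_indices power_add algebra_simps)
  then show ?thesis
    by (simp only: fps_X_geometric_sum zero_less_numeral distrib_left)
qed

text \<open>With \<open>B = 2 ^ j\<close>, the range splits at \<open>3 * B\<close> into halves of
  length \<open>B\<close>, whose last elements \<open>3 * B - 1\<close> and \<open>4 * B - 1\<close>
  are its only exceptional values. The upper half repeats the lower one shifted by
  \<open>12 * B\<close>, whence the last factor of \<open>P_block\<close>.\<close>

lemma P_block_eq_sum:
  "P_block (Suc j) = (\<Sum>q\<in>{2 ^ Suc j..<2 ^ Suc (Suc j)}. fps_indicator (block_indices q))"
proof -
  define B where "B = (2::nat) ^ j"
  have "0 < B" by (simp add: B_def)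
  define c where "c = B - 1"
  have B: "B = Suc c"
    using \<open>0 < B\<close> by (simp add: c_def)
  have exc: "exceptional q \<longleftrightarrow> q + 1 = 3 * B \<or> q + 1 = 4 * B" if "2 * B \<le> q" "q < 4 * B" for q
    using exceptional_in_dyadic_block that by (simp add: B_def)
  let ?f = "\<lambda>q. fps_indicator (block_indices q) :: rat fps"
  define M where "M = (1 - fps_X ^ (12 * c)) / (1 - fps_X ^ 12) * P_VW + fps_X ^ (12 * c) * P_XU"
  have shift: "sum ?f {b..<b + B} = (\<Sum>i<Suc c. ?f (b + i))" for b
    using sum.shift_bounds_nat_ivl[of ?f 0 b B] by (simp add: B atLeast0LessThan add.commute)
  have lower: "sum ?f {2 * B..<3 * B} = fps_X ^ (24 * B + 1) * M"
  proof -
    have "sum ?f {2 * B..<2 * B + B} = fps_X ^ (12 * (2 * B) + 1) * M"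
      unfolding shift M_def by (rule half_block_sum) (auto simp: exc B)
    then show ?thesis by simp
  qed
  have upper: "sum ?f {3 * B..<4 * B} = fps_X ^ (36 * B + 1) * M"
  proof -
    have "sum ?f {3 * B..<3 * B + B} = fps_X ^ (12 * (3 * B) + 1) * M"
      unfolding shift M_def by (rule half_block_sum) (auto simp: exc B)
    then show ?thesis by simp
  qed
  have "sum ?f {2 * B..<4 * B} = sum ?f {2 * B..<3 * B} + sum ?f {3 * B..<4 * B}"
    by (rule sum.atLeastLessThan_concat[symmetric]) simp_all
  also have "\<dots> = fps_X ^ (24 * B + 1) * M * (1 + fps_X ^ (12 * B))"
  proof -
    have "fps_X ^ (36 * B + 1) = (fps_X ^ (24 * B + 1) * fps_X ^ (12 * B) :: rat fps)"
      by (simp flip: power_add)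
    then show ?thesis
      unfolding lower upper by (simp only: distrib_left distrib_right mult_1_right mult_1_left mult_ac)
  qed
  also have "\<dots> = P_block (Suc j)"
    by (simp add: P_block_def B_def c_def M_def)
  finally show ?thesis
    by (simp add: B_def)
qed

definition dyadic_indices :: "nat \<Rightarrow> nat set" where
  "dyadic_indices j = (\<Union>q\<in>{2 ^ Suc j..<2 ^ Suc (Suc j)}. block_indices q)"

lemma P_block_eq_indicator: "P_block (Suc j) = fps_indicator (dyadic_indices j)"
proof -
  have "disjoint_family_on block_indices I" for I
    unfolding disjoint_family_on_def using block_indices_div by blast
  then show ?thesis
    by (simp add: P_block_eq_sum dyadic_indices_def fps_indicator_UN)
qed

lemma dyadic_indicesD:
  "n \<in> dyadic_indices j \<Longrightarrow> 2 ^ Suc j \<le> n div 12 \<and> n div 12 < 2 ^ Suc (Suc j)"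
  using block_indices_div by (auto simp: dyadic_indices_def)

lemma disjoint_dyadic_indices: "disjoint_family dyadic_indices"
proof -
  have "dyadic_indices i \<inter> dyadic_indices j = {}" if "i < j" for i j
  proof -
    have "(2::nat) ^ Suc (Suc i) \<le> 2 ^ Suc j"
      using that by (intro power_increasing) auto
    then show ?thesis
      using dyadic_indicesD by (meson disjoint_iff leD le_trans)
  qed
  then show ?thesis
    unfolding disjoint_family_on_def by (metis Int_commute linorder_neqE_nat)
qed

lemma dyadic_indices_ge:
  assumes "n \<in> dyadic_indices j"
  shows "j \<le> n"
proof -
  have "j < 2 ^ j" by (rule less_exp)
  also have "(2::nat) ^ j \<le> 2 ^ Suc j" by simp
  also have "\<dots> \<le> n div 12" using dyadic_indicesD[OF assms] by simp
  also have "\<dots> \<le> n" by simp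
  finally show ?thesis by simp
qed

lemma UN_dyadic_indices: "(\<Union>j. dyadic_indices j) = (\<Union>q\<in>{2..}. block_indices q)"
proof -
  have "(\<Union>j. {2 ^ Suc j..<2 ^ Suc (Suc j)}) = {2::nat..}"
  proof (intro equalityI subsetI)
    fix q :: nat
    assume "q \<in> (\<Union>j. {2 ^ Suc j..<2 ^ Suc (Suc j)})"
    then obtain j where "2 * 2 ^ j \<le> q" by auto
    moreover have "(1::nat) \<le> 2 ^ j" by simp
    ultimately show "q \<in> {2..}" unfolding atLeast_iff by linarith
  next
    fix q :: nat
    assume "q \<in> {2..}"
    then have q: "2 \<le> q" by simp
    then obtain k where k: "2 ^ k \<le> q" "q < 2 ^ (k + 1)"
      using ex_power_ivl1[of 2 q] by auto
    with q obtain j where "k = Suc j"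
      by (cases k) auto
    with k show "q \<in> (\<Union>j. {2 ^ Suc j..<2 ^ Suc (Suc j)})"
      by auto
  qed
  then show ?thesis
    unfolding dyadic_indices_def by (metis UN_UN_flatten)
qed

lemma P_S_eq: "P_S = fps_indicator {5, 9, 13, 15, 19, 21}"
  by (simp add: P_S_def fps_indicator_insert fps_indicator_empty add.assoc)

theorem theorem7p1:
  shows "infinite weight2_indices
    \<and> summable (\<lambda>n. (fps_X :: rat fps) ^ tau (Suc n))
    \<and> summable (\<lambda>k. P_block (Suc k))
    \<and> (\<Sum>n. (fps_X :: rat fps) ^ tau (Suc n)) = P_S + (\<Sum>k. P_block (Suc k))"
proof -
  \<comment> \<open>Read as indicators of singletons, the powers in the series over
    \<open>tau\<close> also fall under \<open>fps_indicator_sums\<close>: the element enumerated at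
    position \<open>n\<close> is at least \<open>n\<close>.\<close>
  have "disjoint_family (\<lambda>n. {enumerate weight2_indices n})"
    using inj_enumerate[OF infinite_weight2_indices]
    by (auto simp: disjoint_family_on_def inj_on_def)
  moreover have "(\<Union>n. {enumerate weight2_indices n}) = weight2_indices"
    using bij_enumerate[OF infinite_weight2_indices] by (auto simp: bij_betw_def)
  ultimately have tau: "(\<lambda>n. (fps_X :: rat fps) ^ tau (Suc n)) sums fps_indicator weight2_indices"
    using fps_indicator_sums[of "\<lambda>n. {enumerate weight2_indices n}"]
      le_enumerate[OF infinite_weight2_indices]
    by (simp add: fps_indicator_singleton tau_def)
  have blocks: "(\<lambda>k. P_block (Suc k)) sums fps_indicator (\<Union>q\<in>{2..}. block_indices q)"
    using fps_indicator_sums[OF disjoint_dyadic_indices dyadic_indices_ge]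
    by (simp add: P_block_eq_indicator UN_dyadic_indices)
  have "n \<notin> block_indices q" if "n \<in> {5, 9, 13, 15, 19, 21}" "2 \<le> q" for n q
    using that block_indices_div[of n q] by auto
  then have "{5, 9, 13, 15, 19, 21} \<inter> (\<Union>q\<in>{2..}. block_indices q) = {}"
    by blast
  then have "fps_indicator weight2_indices = P_S + fps_indicator (\<Union>q\<in>{2..}. block_indices q)"
    by (simp only: weight2_indices_eq fps_indicator_Un P_S_eq)
  with tau blocks infinite_weight2_indices show ?thesis
    by (simp add: sums_iff)
qed

end
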